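(* Let $n>1$ be an integer. If $a,b\in GP(\mathbb Z_n)$, then the join $a\vee b$ exists in the poset $(\mathbb Z_n,\leq)$, and $a\vee b\in GP(\mathbb Z_n)$.
   Context: On $\mathbb Z_n$ define the partial order $\leq$ by: $a\leq b$ iff $a=b$ or $a\equiv ab\pmod n$. $GP(\mathbb Z_n)$ is the set of $a\in\mathbb Z_n$ with $a^m=a$ for some integer $m\geq2$. *)

theory Defs
  imports "HOL-Number_Theory.Residues" "HOL-Algebra.Lattice"
begin

definition Zn_order :: "int \<Rightarrow> int gorder" where
  "Zn_order n = \<lparr>carrier = carrier (residue_ring n), eq = (=),
                 le = (\<lambda>a b. a = b \<or> [a = a * b] (mod n))\<rparr>"

definition GP :: "int \<Rightarrow> int set" where
  "GP n = {a \<in> carrier (residue_ring n). \<exists>m::nat. m \<ge> 2 \<and> a [^]\<^bsub>residue_ring n\<^esub> m = a}"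

lemma partial_order_Zn_order: "partial_order (Zn_order n)"
proof
  fix x y
  assume le: "x \<sqsubseteq>\<^bsub>Zn_order n\<^esub> y" "y \<sqsubseteq>\<^bsub>Zn_order n\<^esub> x"
    and carr: "x \<in> carrier (Zn_order n)" "y \<in> carrier (Zn_order n)"
  have "[x = y] (mod n)"
    using le by (auto simp: Zn_order_def cong_def mult.commute)
  then have "x = y"
    using carr by (auto simp: Zn_order_def residue_ring_def cong_def)
  then show "x .=\<^bsub>Zn_order n\<^esub> y"
    by (simp add: Zn_order_def)
next
  fix x y z
  assume "x \<sqsubseteq>\<^bsub>Zn_order n\<^esub> y" "y \<sqsubseteq>\<^bsub>Zn_order n\<^esub> z"
  moreover have "[x = x * z] (mod n)" if xy: "[x = x * y] (mod n)" and yz: "[y = y * z] (mod n)"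
  proof -
    have "[x * y = x * (y * z)] (mod n)"
      using yz by (rule cong_scalar_left)
    moreover have "[x * z = x * y * z] (mod n)"
      using xy by (rule cong_scalar_right)
    ultimately show ?thesis
      using xy by (simp add: cong_def mult.assoc)
  qed
  ultimately show "x \<sqsubseteq>\<^bsub>Zn_order n\<^esub> z"
    by (auto simp: Zn_order_def)
qed (auto simp: Zn_order_def)

end

theory Submission
  imports Defs
begin

text \<open>
  If \<open>a\<close> and \<open>b\<close> are comparable, the larger one is the join. Otherwise every upper bound \<open>c\<close> satisfies
  \<open>a c = a\<close> and \<open>b c = b\<close>. Let \<open>e\<close> and \<open>f\<close> be powers of \<open>a\<close> and \<open>b\<close> with \<open>a e = a\<close> and \<open>b f = b\<close>.
  Then \<open>d = e + f - e f\<close> is an upper bound, and \<open>d c = d\<close> for every upper bound \<open>c\<close>, because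
  \<open>e c = e\<close> and \<open>f c = f\<close>. Taking \<open>c = d\<close> shows that \<open>d\<close> is idempotent, hence in \<open>GP\<close>.
\<close>

lemma Zn_order_simps:
  "carrier (Zn_order n) = {0..n - 1}"
  "x \<sqsubseteq>\<^bsub>Zn_order n\<^esub> y \<longleftrightarrow> x = y \<or> [x = x * y] (mod n)"
  by (simp_all add: Zn_order_def residue_ring_def)

text \<open>Since \<open>a\<close> is already reduced, its power in the ring equals \<open>a\<close>
  exactly when the integer power is congruent to \<open>a\<close>; membership thus becomes a
  statement about integers.\<close>

lemma GP_iff:
  assumes "n > 1"
  shows "a \<in> GP n \<longleftrightarrow> a \<in> {0..n - 1} \<and> (\<exists>m\<ge>2. [a ^ m = a] (mod n))"
proof -
  interpret residues n "residue_ring n"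
    using assms by unfold_locales simp_all
  have "a [^]\<^bsub>residue_ring n\<^esub> m = a \<longleftrightarrow> [a ^ m = a] (mod n)" if "a \<in> {0..n - 1}" for m :: nat
    using pow_cong[of a m] that by (simp add: cong_def)
  then show ?thesis
    by (auto simp: GP_def res_carrier_eq)
qed

text \<open>The join is a choice among least upper bounds, and antisymmetry leaves only one, so
  exhibiting one determines the join.\<close>

lemma join_eqI:
  assumes "partial_order L" "least L x (Upper L {a, b})"
  shows "a \<squnion>\<^bsub>L\<^esub> b = x"
proof -
  interpret partial_order L by fact
  have "least L (a \<squnion>\<^bsub>L\<^esub> b) (Upper L {a, b})"
    unfolding join_def sup_def using assms(2) by (rule someI)
  then show ?thesis
    using assms(2) by (rule least_unique)
qed

lemma least_Upper_pair_of_le: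
  assumes "partial_order L" "a \<in> carrier L" "b \<in> carrier L" "a \<sqsubseteq>\<^bsub>L\<^esub> b"
  shows "least L b (Upper L {a, b})"
proof -
  interpret partial_order L by fact
  show ?thesis
    using assms by (auto simp: least_def Upper_def)
qed

text \<open>The witness is \<open>e = a ^ (m - 1)\<close>. As \<open>m \<ge> 2\<close>, it still has
  a factor \<open>a\<close>, so whatever fixes \<open>a\<close> under multiplication also fixes
  \<open>e\<close>.\<close>

lemma GP_local_unit:
  assumes "n > 1" "a \<in> GP n"
  obtains e where "[a * e = a] (mod n)" "\<And>c. [a * c = a] (mod n) \<Longrightarrow> [e * c = e] (mod n)"
proof -
  obtain m where "m \<ge> 2" and m: "[a ^ m = a] (mod n)"
    using assms by (auto simp: GP_iff)
  then obtain k where k: "m = Suc (Suc k)"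
    by (metis Suc_le_D numeral_2_eq_2 Suc_le_mono)
  show thesis
  proof
    show "[a * a ^ Suc k = a] (mod n)"
      using m by (simp add: k)
    show "[a ^ Suc k * c = a ^ Suc k] (mod n)" if "[a * c = a] (mod n)" for c
      using cong_scalar_left[OF that, of "a ^ k"] by (simp add: mult_ac)
  qed
qed

lemma least_Upper_GP_incomparable:
  assumes n: "n > 1" and "a \<in> GP n" "b \<in> GP n"
    and incomparable: "\<not> a \<sqsubseteq>\<^bsub>Zn_order n\<^esub> b" "\<not> b \<sqsubseteq>\<^bsub>Zn_order n\<^esub> a"
  obtains d where "d \<in> GP n" "least (Zn_order n) d (Upper (Zn_order n) {a, b})"
proof -
  obtain e where ae: "[a * e = a] (mod n)"
    and ec: "\<And>c. [a * c = a] (mod n) \<Longrightarrow> [e * c = e] (mod n)"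
    using GP_local_unit[OF n \<open>a \<in> GP n\<close>] by blast
  obtain f where bf: "[b * f = b] (mod n)"
    and fc: "\<And>c. [b * c = b] (mod n) \<Longrightarrow> [f * c = f] (mod n)"
    using GP_local_unit[OF n \<open>b \<in> GP n\<close>] by blast
  \<comment> \<open>This is \<open>1 - (1 - e) * (1 - f)\<close>, reduced so that it lies in the
    carrier.\<close>
  define d where "d = (e + f - e * f) mod n"
  have d: "[d = e + f - e * f] (mod n)"
    by (simp add: d_def cong_def)
  have dcarr: "d \<in> {0..n - 1}"
    using n by (simp add: d_def)
  have ad: "[a * d = a] (mod n)"
  proof -
    have "[a * d = a * (e + f - e * f)] (mod n)"
      using d by (rule cong_scalar_left)
    \<comment> \<open>Grouping \<open>a * e\<close> lets both occurrences become \<open>a\<close>,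
      after which the terms in \<open>f\<close> cancel.\<close>
    also have "a * (e + f - e * f) = a * e + a * f - (a * e) * f"
      by (simp add: algebra_simps)
    also have "[\<dots> = a + a * f - a * f] (mod n)"
      by (intro cong_add cong_diff cong_mult ae cong_refl)
    finally show ?thesis by simp
  qed
  have bd: "[b * d = b] (mod n)"
  proof -
    have "[b * d = b * (e + f - e * f)] (mod n)"
      using d by (rule cong_scalar_left)
    also have "b * (e + f - e * f) = b * e + b * f - (b * f) * e"
      by (simp add: algebra_simps)
    also have "[\<dots> = b * e + b - b * e] (mod n)"
      by (intro cong_add cong_diff cong_mult bf cong_refl)
    finally show ?thesis by simp
  qed
  have dc: "[d * c = d] (mod n)" if "[a * c = a] (mod n)" "[b * c = b] (mod n)" for c
  proof -
    have "[d * c = (e + f - e * f) * c] (mod n)"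
      using d by (rule cong_scalar_right)
    also have "(e + f - e * f) * c = e * c + f * c - e * (f * c)"
      by (simp add: algebra_simps)
    also have "[\<dots> = e + f - e * f] (mod n)"
      by (intro cong_add cong_diff cong_mult ec fc that cong_refl)
    also have "[e + f - e * f = d] (mod n)"
      using d by (rule cong_sym)
    finally show ?thesis .
  qed
  have "[d ^ 2 = d] (mod n)"
    using dc[OF ad bd] by (simp add: power2_eq_square)
  then have "d \<in> GP n"
    using dcarr n by (auto simp: GP_iff)
  moreover have "least (Zn_order n) d (Upper (Zn_order n) {a, b})"
  proof -
    have "d \<in> Upper (Zn_order n) {a, b}"
      using dcarr ad bd by (auto simp: Upper_def Zn_order_simps cong_sym)
    moreover have "d \<sqsubseteq>\<^bsub>Zn_order n\<^esub> c" if "c \<in> Upper (Zn_order n) {a, b}" for c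
    proof -
      have "a \<in> {0..n - 1}" "b \<in> {0..n - 1}"
        using assms by (auto simp: GP_iff)
      then have le: "a \<sqsubseteq>\<^bsub>Zn_order n\<^esub> c" "b \<sqsubseteq>\<^bsub>Zn_order n\<^esub> c"
        using that by (auto simp: Upper_def Zn_order_simps(1))
      \<comment> \<open>The order also holds by mere equality. But \<open>c = a\<close> would put
        \<open>b\<close> below \<open>a\<close>, and \<open>c = b\<close> would put \<open>a\<close>
        below \<open>b\<close>, so only the congruences remain.\<close>
      moreover have "c \<noteq> a" "c \<noteq> b"
        using le incomparable by auto
      ultimately have "[a * c = a] (mod n)" "[b * c = b] (mod n)"
        by (auto simp: Zn_order_simps cong_sym)
      then show ?thesis
        using dc by (simp add: Zn_order_simps cong_sym)
    qed
    moreover have "Upper (Zn_order n) {a, b} \<subseteq> carrier (Zn_order n)"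
      by (rule Upper_closed)
    ultimately show ?thesis
      by (simp add: least_def)
  qed
  ultimately show thesis
    by (rule that)
qed

theorem theorem3p9:
  fixes n a b :: int
  assumes "n > 1"
    and "a \<in> GP n" and "b \<in> GP n"
  shows "least (Zn_order n) (a \<squnion>\<^bsub>Zn_order n\<^esub> b) (Upper (Zn_order n) {a, b})
       \<and> a \<squnion>\<^bsub>Zn_order n\<^esub> b \<in> GP n"
proof -
  have carr: "a \<in> carrier (Zn_order n)" "b \<in> carrier (Zn_order n)"
    using assms by (auto simp: GP_iff Zn_order_simps)
  obtain d where "d \<in> GP n" "least (Zn_order n) d (Upper (Zn_order n) {a, b})"
  proof (cases "a \<sqsubseteq>\<^bsub>Zn_order n\<^esub> b \<or> b \<sqsubseteq>\<^bsub>Zn_order n\<^esub> a")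
    case True
    then show thesis
      using that assms carr least_Upper_pair_of_le[OF partial_order_Zn_order]
      \<comment> \<open>The larger of the two serves as \<open>d\<close>; swapping the pair covers
        \<open>b\<close> below \<open>a\<close>.\<close>
      by (metis insert_commute)
  next
    case False
    then show thesis
      using that least_Upper_GP_incomparable[OF assms] by blast
  qed
  then show ?thesis
    using join_eqI[OF partial_order_Zn_order] by simp
qed

end
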